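(* Let $G=(D\cup\{b\},E,w,\lambda)$ be a weighted decoding graph, let $\sigma\subseteq D$ be a syndrome, and let $\varphi$ be a relabelling of $G$ with relabelled graph $\varphi G$, edge set $\varphi E$ and relabelled syndrome $\varphi\sigma$. Let $S_1\subseteq E$ and $S_2'\subseteq\varphi E$ satisfy $\partial_D S_1=\sigma$ and $\partial_D S_2'=\varphi\sigma$ (the latter computed in $\varphi G$), and write $S_2=\varphi^{-1}(S_2')\subseteq E$. If $W(S_1)\neq W(S_2)$, then the heavier of $S_1,S_2$ is not a minimum-weight explanation of $\sigma$, i.e. it does not attain $\min\{W(S): S\subseteq E,\ \partial_D S=\sigma\}$.
   Context: A weighted decoding graph $G=(D\cup\{b\},E,w,\lambda)$ is a finite multigraph: $D$ is a finite set of detectors, $b\notin D$ is a virtual boundary vertex, each edge joins two distinct detectors or joins one detector to $b$ (edges carry identities, so parallel edges are distinct), $w:E\to\mathbb{R}_{>0}$ gives edge weights, and $\lambda:E\to\mathbb{F}_2^k$ records which of $k$ declared observables each edge flips. For a set $S$ of edges, $\partial_D S$ is the set of detectors (never including the boundary vertex) incident to an odd number of edges of $S$, and $W(S)=\sum_{e\in S}w_e$. A set $S$ explains (is feasible for) $\sigma$ when $\partial_D S=\sigma$. A relabelling $\varphi$ is a pair of bijections, one from $D\cup\{b\}$ onto the vertex set of the relabelled graph $\varphi G$ sending the boundary vertex to the boundary vertex, and one from $E$ onto the edge set $\varphi E$ of $\varphi G$, that preserves incidence (the endpoints of $\varphi e$ are the images of the endpoints of $e$), preserves weights ($w(\varphi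 e)=w(e)$) and preserves observable labels ($\lambda(\varphi e)=\lambda(e)$). $\varphi\sigma$ is the image of $\sigma$ under the vertex bijection, and $\varphi^{-1}(S_2')$ is the preimage under the edge bijection. *)

theory Defs
  imports Complex_Main "HOL-Library.Z2" "HOL-Library.FuncSet"
begin

text \<open>Edges carry their own identities, so parallel edges are distinct elements with equal
  endpoint sets. Vectors over the two-element field are extensional functions from
  \<open>{..<k}\<close> to \<^typ>\<open>bit\<close>, which also covers \<open>k = 0\<close>.\<close>

record ('v, 'e) decoding_graph =
  detectors :: "'v set"
  boundary_vertex :: 'v
  edges :: "'e set"
  endpoints :: "'e \<Rightarrow> 'v set"
  edge_weight :: "'e \<Rightarrow> real"
  num_observables :: nat
  observable_label :: "'e \<Rightarrow> nat \<Rightarrow> bit"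

definition vertices :: "('v, 'e) decoding_graph \<Rightarrow> 'v set" where
  "vertices G = insert (boundary_vertex G) (detectors G)"

definition weighted_decoding_graph :: "('v, 'e) decoding_graph \<Rightarrow> bool" where
  "weighted_decoding_graph G \<longleftrightarrow>
     finite (detectors G) \<and> finite (edges G) \<and>
     boundary_vertex G \<notin> detectors G \<and>
     (\<forall>e\<in>edges G. \<exists>u\<in>detectors G. \<exists>v\<in>vertices G. u \<noteq> v \<and> endpoints G e = {u, v}) \<and>
     (\<forall>e\<in>edges G. edge_weight G e > 0) \<and>
     (\<forall>e\<in>edges G. observable_label G e \<in> {..<num_observables G} \<rightarrow>\<^sub>E UNIV)"

definition detector_boundary :: "('v, 'e) decoding_graph \<Rightarrow> 'e set \<Rightarrow> 'v set" where
  "detector_boundary G S = {d \<in> detectors G. odd (card {e \<in> S. d \<in> endpoints G e})}"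

definition total_weight :: "('v, 'e) decoding_graph \<Rightarrow> 'e set \<Rightarrow> real" where
  "total_weight G S = (\<Sum>e\<in>S. edge_weight G e)"

definition explains :: "('v, 'e) decoding_graph \<Rightarrow> 'v set \<Rightarrow> 'e set \<Rightarrow> bool" where
  "explains G \<sigma> S \<longleftrightarrow> S \<subseteq> edges G \<and> detector_boundary G S = \<sigma>"

text \<open>Only meaningful when some edge set explains \<open>\<sigma>\<close>: \<^const>\<open>Min\<close> is
  unspecified on the empty set.\<close>

definition min_explanation_weight :: "('v, 'e) decoding_graph \<Rightarrow> 'v set \<Rightarrow> real" where
  "min_explanation_weight G \<sigma> = Min {total_weight G S | S. explains G \<sigma> S}"

definition minimum_weight_explanation ::
    "('v, 'e) decoding_graph \<Rightarrow> 'v set \<Rightarrow> 'e set \<Rightarrow> bool" where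
  "minimum_weight_explanation G \<sigma> S \<longleftrightarrow>
     explains G \<sigma> S \<and> total_weight G S = min_explanation_weight G \<sigma>"

text \<open>The relabelled graph \<open>G'\<close> may live on other vertex and edge types; only the
  restrictions of \<open>\<phi>V\<close> and \<open>\<phi>E\<close> to the vertices and edges of \<open>G\<close> matter.\<close>

definition relabelling ::
    "('v, 'e) decoding_graph \<Rightarrow> ('v \<Rightarrow> 'w) \<Rightarrow> ('e \<Rightarrow> 'f) \<Rightarrow> ('w, 'f) decoding_graph \<Rightarrow> bool" where
  "relabelling G \<phi>V \<phi>E G' \<longleftrightarrow>
     bij_betw \<phi>V (vertices G) (vertices G') \<and>
     \<phi>V (boundary_vertex G) = boundary_vertex G' \<and>
     bij_betw \<phi>E (edges G) (edges G') \<and>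
     (\<forall>e\<in>edges G. endpoints G' (\<phi>E e) = \<phi>V ` endpoints G e) \<and>
     (\<forall>e\<in>edges G. edge_weight G' (\<phi>E e) = edge_weight G e) \<and>
     num_observables G' = num_observables G \<and>
     (\<forall>e\<in>edges G. observable_label G' (\<phi>E e) = observable_label G e)"

text \<open>The heavier of two edge sets; used only for sets of different total weight.\<close>

definition heavier :: "('v, 'e) decoding_graph \<Rightarrow> 'e set \<Rightarrow> 'e set \<Rightarrow> 'e set" where
  "heavier G S T = (if total_weight G S > total_weight G T then S else T)"

end

theory Submission
  imports Defs
begin

text \<open>A relabelling commutes with the detector boundary, so \<open>S2\<close> explains \<open>\<sigma>\<close> in \<open>G\<close> just as
  \<open>S1\<close> does. The lighter of the two is then an explanation of weight strictly below that of the
  heavier one.\<close>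

lemma endpoints_subset_vertices:
  assumes "weighted_decoding_graph G" and "e \<in> edges G"
  shows "endpoints G e \<subseteq> vertices G"
  using assms unfolding weighted_decoding_graph_def vertices_def by fastforce

text \<open>The vertex bijection matches the two boundary vertices, and neither of these is a
  detector, so deleting them from both vertex sets leaves a bijection of the detectors.\<close>

lemma relabelling_image_detectors:
  assumes "weighted_decoding_graph G" and "weighted_decoding_graph G'"
    and "relabelling G \<phi>V \<phi>E G'"
  shows "\<phi>V ` detectors G = detectors G'"
proof -
  have b: "boundary_vertex G \<notin> detectors G" "boundary_vertex G' \<notin> detectors G'"
    using assms by (auto simp: weighted_decoding_graph_def)
  have inj: "inj_on \<phi>V (vertices G)" and img: "\<phi>V ` vertices G = vertices G'"
    and fixb: "\<phi>V (boundary_vertex G) = boundary_vertex G'"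
    using assms(3) by (auto simp: relabelling_def bij_betw_def)
  have "\<phi>V ` detectors G = \<phi>V ` (vertices G - {boundary_vertex G})"
    using b(1) by (simp add: vertices_def)
  also have "\<dots> = vertices G' - {boundary_vertex G'}"
    using inj_on_image_set_diff[OF inj, of "vertices G" "{boundary_vertex G}"] img fixb
    by (auto simp: vertices_def)
  also have "\<dots> = detectors G'"
    using b(2) by (simp add: vertices_def)
  finally show ?thesis .
qed

text \<open>Injectivity on vertices makes incidence hold in \<open>G'\<close> exactly when it holds
  in \<open>G\<close>, and injectivity on edges keeps the count of incident edges, hence its parity,
  at each detector.\<close>

lemma relabelling_detector_boundary:
  assumes "weighted_decoding_graph G" and "weighted_decoding_graph G'"
    and "relabelling G \<phi>V \<phi>E G'" and "S \<subseteq> edges G"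
  shows "detector_boundary G' (\<phi>E ` S) = \<phi>V ` detector_boundary G S"
proof -
  have injV: "inj_on \<phi>V (vertices G)" and injE: "inj_on \<phi>E (edges G)"
    and ends: "\<And>e. e \<in> edges G \<Longrightarrow> endpoints G' (\<phi>E e) = \<phi>V ` endpoints G e"
    using assms(3) by (auto simp: relabelling_def bij_betw_def)
  have "card {f \<in> \<phi>E ` S. \<phi>V d \<in> endpoints G' f} = card {e \<in> S. d \<in> endpoints G e}"
    if "d \<in> detectors G" for d
  proof -
    have "\<phi>V d \<in> endpoints G' (\<phi>E e) \<longleftrightarrow> d \<in> endpoints G e" if "e \<in> S" for e
    proof -
      have e: "e \<in> edges G" using that assms(4) by blast
      have "d \<in> vertices G" using \<open>d \<in> detectors G\<close> by (simp add: vertices_def)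
      then show ?thesis
        \<comment> \<open>\<open>\<phi>V\<close> is known to be injective only on
          \<open>vertices G\<close>, so both \<open>d\<close> and the endpoints of \<open>e\<close>
          must lie there.\<close>
        using inj_on_image_mem_iff[OF injV _ endpoints_subset_vertices[OF assms(1) e]] ends[OF e]
        by simp
    qed
    then have "{f \<in> \<phi>E ` S. \<phi>V d \<in> endpoints G' f} = \<phi>E ` {e \<in> S. d \<in> endpoints G e}"
      by auto
    moreover have "inj_on \<phi>E {e \<in> S. d \<in> endpoints G e}"
      using injE by (rule inj_on_subset) (use assms(4) in auto)
    ultimately show ?thesis by (simp add: card_image)
  qed
  \<comment> \<open>Writing \<open>detectors G'\<close> as an image gives each of its members the
    form \<open>\<phi>V d\<close>, to which the equality of counts applies.\<close>
  then show ?thesis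
    unfolding detector_boundary_def relabelling_image_detectors[OF assms(1-3), symmetric]
    by auto
qed

text \<open>Surjectivity of \<open>\<phi>E\<close> onto \<open>edges G'\<close> recovers
  \<open>S'\<close> as the image of its preimage; commutation with the boundary then gives the claim
  up to \<open>\<phi>V\<close>, which cancels.\<close>

lemma explains_relabelling_vimage:
  assumes "weighted_decoding_graph G" and "weighted_decoding_graph G'"
    and "relabelling G \<phi>V \<phi>E G'" and "\<sigma> \<subseteq> detectors G" and "explains G' (\<phi>V ` \<sigma>) S'"
  shows "explains G \<sigma> (\<phi>E -` S' \<inter> edges G)"
proof -
  let ?S = "\<phi>E -` S' \<inter> edges G"
  have injV: "inj_on \<phi>V (vertices G)" and imgE: "\<phi>E ` edges G = edges G'"
    using assms(3) by (auto simp: relabelling_def bij_betw_def)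
  have "S' \<subseteq> \<phi>E ` edges G"
    using assms(5) imgE by (simp add: explains_def)
  then have "\<phi>E ` ?S = S'" by blast
  then have "\<phi>V ` detector_boundary G ?S = \<phi>V ` \<sigma>"
    using relabelling_detector_boundary[OF assms(1-3), of ?S] assms(5)
    by (simp add: explains_def)
  \<comment> \<open>Both sets consist of detectors, so they lie where \<open>\<phi>V\<close> is
    injective.\<close>
  then have "detector_boundary G ?S = \<sigma>"
    using assms(4) inj_on_image_eq_iff[OF injV, of "detector_boundary G ?S" \<sigma>]
    by (auto simp: detector_boundary_def vertices_def)
  then show ?thesis by (simp add: explains_def)
qed

text \<open>\<open>Min\<close> is a lower bound only for finite sets; finitely many edges admit only
  finitely many explanation weights.\<close>

lemma min_explanation_weight_le:
  assumes "weighted_decoding_graph G" and "explains G \<sigma> S"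
  shows "min_explanation_weight G \<sigma> \<le> total_weight G S"
proof -
  have "{total_weight G T | T. explains G \<sigma> T} \<subseteq> total_weight G ` Pow (edges G)"
    by (auto simp: explains_def)
  moreover have "finite (edges G)"
    using assms(1) by (simp add: weighted_decoding_graph_def)
  ultimately have "finite {total_weight G T | T. explains G \<sigma> T}"
    by (meson finite_Pow_iff finite_imageI finite_subset)
  then show ?thesis
    unfolding min_explanation_weight_def using assms(2) by (intro Min_le) auto
qed

theorem lemma5p3:
  fixes G :: "('v, 'e) decoding_graph" and G' :: "('w, 'f) decoding_graph"
    and \<phi>V :: "'v \<Rightarrow> 'w" and \<phi>E :: "'e \<Rightarrow> 'f"
    and \<sigma> :: "'v set" and S1 S2 :: "'e set" and S2' :: "'f set"
  assumes "weighted_decoding_graph G"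
    and "\<sigma> \<subseteq> detectors G"
    and "weighted_decoding_graph G'"
    and "relabelling G \<phi>V \<phi>E G'"
    and "S1 \<subseteq> edges G" and "detector_boundary G S1 = \<sigma>"
    and "S2' \<subseteq> edges G'" and "detector_boundary G' S2' = \<phi>V ` \<sigma>"
    and "S2 = \<phi>E -` S2' \<inter> edges G"
    and "total_weight G S1 \<noteq> total_weight G S2"
  shows "\<not> minimum_weight_explanation G \<sigma> (heavier G S1 S2) \<and>
         total_weight G (heavier G S1 S2) \<noteq> min_explanation_weight G \<sigma>"
proof -
  have "explains G \<sigma> S1"
    using assms(5,6) by (simp add: explains_def)
  then have "min_explanation_weight G \<sigma> \<le> total_weight G S1"
    by (rule min_explanation_weight_le[OF assms(1)])
  moreover have "explains G \<sigma> S2"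
    using explains_relabelling_vimage[OF assms(1,3,4,2)] assms(7-9) by (simp add: explains_def)
  then have "min_explanation_weight G \<sigma> \<le> total_weight G S2"
    by (rule min_explanation_weight_le[OF assms(1)])
  \<comment> \<open>The minimum is at most the smaller weight, which is strictly below the larger
    one since ties are excluded.\<close>
  ultimately have "total_weight G (heavier G S1 S2) \<noteq> min_explanation_weight G \<sigma>"
    using assms(10) by (auto simp: heavier_def)
  then show ?thesis
    by (simp add: minimum_weight_explanation_def)
qed

end
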